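(* Let $X$ and $Y$ be real Banach spaces. The projective tensor product $X\widehat{\otimes}_\pi Y$ has $BDP$ if and only if $X$ and $Y$ both have $BDP$.
   Context: All Banach spaces are real; $B_Z$, $S_Z$ denote the closed unit ball and unit sphere of $Z$. $X\widehat{\otimes}_\pi Y$ is the completion of the algebraic tensor product $X\otimes Y$ under the projective norm $\|u\|_\pi=\inf\{\sum_{i=1}^n\|x_i\|\|y_i\| : u=\sum_{i=1}^n x_i\otimes y_i\}$. A slice of $B_Z$ is a set $\{z\in B_Z: z^*(z)>1-\alpha\}$ with $z^*\in S_{Z^*}$, $0<\alpha<1$. $Z$ has $BDP$ (Ball Dentable Property) if $B_Z$ has slices of arbitrarily small diameter. *)

theory Defs
  imports "HOL-Analysis.Analysis" "HOL-Analysis.Finite_Function_Topology"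
begin

section \<open>The algebraic tensor product\<close>

text \<open>The quotient of the free real vector space on pairs by the span of the bilinearity relations.\<close>

definition formal_tensor :: "'a \<Rightarrow> 'b \<Rightarrow> (('a \<times> 'b) \<Rightarrow>\<^sub>0 real)" where
  "formal_tensor x y = Poly_Mapping.single (x, y) 1"

definition tensor_relations :: "(('a::real_vector \<times> 'b::real_vector) \<Rightarrow>\<^sub>0 real) set" where
  "tensor_relations =
     {formal_tensor (x + x') y - formal_tensor x y - formal_tensor x' y | x x' y. True} \<union>
     {formal_tensor x (y + y') - formal_tensor x y - formal_tensor x y' | x y y'. True} \<union>
     {formal_tensor (c *\<^sub>R x) y - c *\<^sub>R formal_tensor x y | c x y. True} \<union>
     {formal_tensor x (c *\<^sub>R y) - c *\<^sub>R formal_tensor x y | c x y. True}"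

definition tensor_rel ::
  "(('a::real_vector \<times> 'b::real_vector) \<Rightarrow>\<^sub>0 real) \<Rightarrow> (('a \<times> 'b) \<Rightarrow>\<^sub>0 real) \<Rightarrow> bool" where
  "tensor_rel u v \<longleftrightarrow> u - v \<in> span tensor_relations"

lemma equivp_tensor_rel: "equivp tensor_rel"
proof (rule equivpI)
  show "reflp tensor_rel"
    by (simp add: reflp_def tensor_rel_def span_zero)
  show "symp tensor_rel"
    unfolding symp_def tensor_rel_def by (metis minus_diff_eq span_neg)
  show "transp tensor_rel"
    unfolding transp_def tensor_rel_def using span_add by fastforce
qed

quotient_type (overloaded) ('a, 'b) tensor = "(('a::real_vector \<times> 'b::real_vector) \<Rightarrow>\<^sub>0 real)" / tensor_rel
  by (rule equivp_tensor_rel)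

instantiation tensor :: (real_vector, real_vector) real_vector
begin

lift_definition zero_tensor :: "('a, 'b) tensor" is 0 .

lift_definition plus_tensor :: "('a, 'b) tensor \<Rightarrow> ('a, 'b) tensor \<Rightarrow> ('a, 'b) tensor" is "(+)"
  unfolding tensor_rel_def by (drule (1) span_add) (simp add: algebra_simps)

lift_definition uminus_tensor :: "('a, 'b) tensor \<Rightarrow> ('a, 'b) tensor" is uminus
  unfolding tensor_rel_def by (drule span_neg) (simp add: algebra_simps)

lift_definition minus_tensor :: "('a, 'b) tensor \<Rightarrow> ('a, 'b) tensor \<Rightarrow> ('a, 'b) tensor" is "(-)"
  unfolding tensor_rel_def by (drule (1) span_diff) (simp add: algebra_simps)

lift_definition scaleR_tensor :: "real \<Rightarrow> ('a, 'b) tensor \<Rightarrow> ('a, 'b) tensor" is scaleR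
  unfolding tensor_rel_def by (drule span_scale) (simp add: scaleR_diff_right)

instance
  by (standard; transfer)
     (simp_all add: tensor_rel_def algebra_simps span_zero)

end

lift_definition tensor_prod :: "'a::real_vector \<Rightarrow> 'b::real_vector \<Rightarrow> ('a, 'b) tensor" (infix "\<otimes>" 75)
  is formal_tensor .

lemma tensor_relE: "u - v \<in> tensor_relations \<Longrightarrow> tensor_rel u v"
  unfolding tensor_rel_def by (rule span_base)

lemma tensor_add_left: "(x + x') \<otimes> y = x \<otimes> y + x' \<otimes> y"
  by transfer (rule tensor_relE, force simp: tensor_relations_def diff_diff_eq)

lemma tensor_add_right: "x \<otimes> (y + y') = x \<otimes> y + x \<otimes> y'"
  by transfer (rule tensor_relE, force simp: tensor_relations_def diff_diff_eq)

lemma tensor_scale_left: "(c *\<^sub>R x) \<otimes> y = c *\<^sub>R (x \<otimes> y)"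
  by transfer (rule tensor_relE, force simp: tensor_relations_def)

lemma tensor_scale_right: "x \<otimes> (c *\<^sub>R y) = c *\<^sub>R (x \<otimes> y)"
  by transfer (rule tensor_relE, force simp: tensor_relations_def)

lemma bilinear_tensor: "bilinear (\<otimes>)"
  unfolding bilinear_def
  by (auto intro!: linearI simp: tensor_add_left tensor_add_right tensor_scale_left tensor_scale_right)

lemma tensor_zero_left [simp]: "0 \<otimes> y = 0"
  using tensor_scale_left[of 0 0 y] by simp

lemma tensor_zero_right [simp]: "x \<otimes> 0 = 0"
  using tensor_scale_right[of x 0 0] by simp

lemma lookup_scaleR_pm: "Poly_Mapping.lookup (c *\<^sub>R u) k = c * Poly_Mapping.lookup u k"
  for u :: "('k \<Rightarrow>\<^sub>0 real)"
proof -
  have "finite {i. c *\<^sub>R Poly_Mapping.lookup u i \<noteq> 0}"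
    by (rule finite_subset[OF _ finite_keys[of u]]) (auto simp: in_keys_iff)
  then show ?thesis
    by (simp add: scaleR_poly_mapping_def Abs_poly_mapping_inverse)
qed

abbreviation tensor_sum :: "('a::real_vector \<times> 'b::real_vector) list \<Rightarrow> ('a, 'b) tensor" where
  "tensor_sum xs \<equiv> (\<Sum>(x, y)\<leftarrow>xs. x \<otimes> y)"

lemma scaleR_tensor_sum: "c *\<^sub>R tensor_sum xs = tensor_sum (map (\<lambda>(x, y). (c *\<^sub>R x, y)) xs)"
  by (induction xs) (auto simp: scaleR_add_right tensor_scale_left)

lemma tensor_sum_exists: "\<exists>xs. u = tensor_sum xs"
proof (induction u rule: tensor.abs_induct)
  case (1 u)
  show ?case
  proof (induction u rule: update_induct)
    case const
    show ?case
      by (rule exI[of _ "[]"]) (simp add: zero_tensor.abs_eq)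
  next
    case (update f k c)
    obtain xs where xs: "abs_tensor f = tensor_sum xs" using update by blast
    obtain x y where k: "k = (x, y)" by fastforce
    have "Poly_Mapping.update k c f = c *\<^sub>R formal_tensor x y + f"
      using update(1)
      by (intro poly_mapping_eqI)
         (auto simp: lookup_update lookup_add lookup_scaleR_pm formal_tensor_def k lookup_single
            in_keys_iff when_def)
    then have "abs_tensor (Poly_Mapping.update k c f) = c *\<^sub>R (x \<otimes> y) + abs_tensor f"
      by (simp add: tensor_prod.abs_eq plus_tensor.abs_eq scaleR_tensor.abs_eq)
    also have "\<dots> = tensor_sum ((c *\<^sub>R x, y) # xs)"
      by (simp add: xs tensor_scale_left)
    finally show ?case by blast
  qed
qed

definition pm_extend :: "('k \<Rightarrow> 'c::real_vector) \<Rightarrow> ('k \<Rightarrow>\<^sub>0 real) \<Rightarrow> 'c" where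
  "pm_extend b u = (\<Sum>k\<in>Poly_Mapping.keys u. Poly_Mapping.lookup u k *\<^sub>R b k)"

lemma pm_extend_superset:
  "finite A \<Longrightarrow> Poly_Mapping.keys u \<subseteq> A \<Longrightarrow> pm_extend b u = (\<Sum>k\<in>A. Poly_Mapping.lookup u k *\<^sub>R b k)"
  unfolding pm_extend_def by (rule sum.mono_neutral_left) (auto simp: in_keys_iff)

lemma linear_pm_extend: "linear (pm_extend (b :: 'k \<Rightarrow> _))"
proof (rule linearI)
  fix u v :: "'k \<Rightarrow>\<^sub>0 real"
  let ?A = "Poly_Mapping.keys u \<union> Poly_Mapping.keys v"
  have "pm_extend b (u + v) = (\<Sum>k\<in>?A. Poly_Mapping.lookup (u + v) k *\<^sub>R b k)"
    using keys_add[of u v] by (intro pm_extend_superset) auto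
  then show "pm_extend b (u + v) = pm_extend b u + pm_extend b v"
    by (simp add: pm_extend_superset[of ?A u] pm_extend_superset[of ?A v] lookup_add
        scaleR_add_left sum.distrib)
next
  fix c and u :: "'k \<Rightarrow>\<^sub>0 real"
  have "pm_extend b (c *\<^sub>R u) = (\<Sum>k\<in>Poly_Mapping.keys u. Poly_Mapping.lookup (c *\<^sub>R u) k *\<^sub>R b k)"
    by (rule pm_extend_superset) (auto simp: in_keys_iff lookup_scaleR_pm)
  then show "pm_extend b (c *\<^sub>R u) = c *\<^sub>R pm_extend b u"
    by (simp add: pm_extend_def lookup_scaleR_pm scaleR_sum_right)
qed

lemma tensor_universal:
  fixes B :: "'a::real_vector \<Rightarrow> 'b::real_vector \<Rightarrow> 'c::real_vector"
  assumes "bilinear B"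
  shows "\<exists>T. linear T \<and> (\<forall>x y. T (x \<otimes> y) = B x y)"
proof -
  let ?b = "\<lambda>(x, y). B x y"
  interpret E: linear "pm_extend ?b" by (rule linear_pm_extend)
  have gen: "pm_extend ?b (formal_tensor x y) = B x y" for x y
    by (simp add: pm_extend_def formal_tensor_def)
  have rel: "pm_extend ?b r = 0" if "r \<in> tensor_relations" for r
    using that assms unfolding tensor_relations_def
    by (auto simp: E.diff E.scale gen bilinear_ladd bilinear_radd bilinear_lmul bilinear_rmul)
  have "pm_extend ?b r = 0" if "r \<in> span tensor_relations" for r
    using linear_eq_0_on_span[OF linear_pm_extend _ that] rel by blast
  then have resp: "pm_extend ?b u = pm_extend ?b v" if "tensor_rel u v" for u v
    using that E.diff[of u v] by (auto simp: tensor_rel_def)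
  define T where "T u = pm_extend ?b (rep_tensor u)" for u
  have T_abs: "T (abs_tensor u) = pm_extend ?b u" for u
    unfolding T_def by (rule resp) (metis tensor.abs_eq_iff Quotient3_abs_rep Quotient3_tensor)
  have "linear T"
  proof (rule linearI)
    show "T (u + v) = T u + T v" for u v
      by (induction u, induction v) (simp add: plus_tensor.abs_eq T_abs E.add)
    show "T (c *\<^sub>R u) = c *\<^sub>R T u" for c u
      by (induction u) (simp add: scaleR_tensor.abs_eq T_abs E.scale)
  qed
  moreover have "T (x \<otimes> y) = B x y" for x y
    by (simp add: tensor_prod.abs_eq T_abs gen)
  ultimately show ?thesis by blast
qed

section \<open>Bounded functionals separate points\<close>

text \<open>A Hahn--Banach argument, needed for the projective seminorm to be a norm.\<close>

definition sublinear :: "('a::real_vector \<Rightarrow> real) \<Rightarrow> bool" where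
  "sublinear p \<longleftrightarrow> (\<forall>x y. p (x + y) \<le> p x + p y) \<and> (\<forall>c x. 0 \<le> c \<longrightarrow> p (c *\<^sub>R x) = c * p x)"

lemma sublinear_lower: assumes "sublinear p" shows "- p (- x) \<le> p x"
proof -
  have "p (0 *\<^sub>R x) = 0 * p x" "p (x + - x) \<le> p x + p (- x)"
    using assms unfolding sublinear_def by blast+
  then show ?thesis by simp
qed

lemma sublinear_INF:
  assumes ne: "C \<noteq> {}" and sub: "\<And>p. p \<in> C \<Longrightarrow> sublinear p"
    and bdd: "\<And>x. bdd_below ((\<lambda>p. p x) ` C)"
    and dir: "\<And>p r. p \<in> C \<Longrightarrow> r \<in> C \<Longrightarrow> (\<And>x y. \<exists>s\<in>C. s (x + y) \<le> p x + r y)"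
  shows "sublinear (\<lambda>x. INF p\<in>C. p x)"
  unfolding sublinear_def
proof (intro conjI allI impI)
  fix x y
  let ?I = "\<lambda>x. INF p\<in>C. p x"
  have 1: "?I (x + y) \<le> p x + r y" if pr: "p \<in> C" "r \<in> C" for p r
  proof -
    obtain s where "s \<in> C" "s (x + y) \<le> p x + r y" using dir[OF pr] by blast
    then show ?thesis using cINF_lower[OF bdd] by (meson order_trans)
  qed
  have "?I (x + y) - r y \<le> ?I x" if "r \<in> C" for r
    by (rule cINF_greatest[OF ne]) (use 1[OF _ that] in \<open>simp add: algebra_simps\<close>)
  then have "?I (x + y) - ?I x \<le> ?I y"
    by (intro cINF_greatest[OF ne]) (simp add: algebra_simps)
  then show "?I (x + y) \<le> ?I x + ?I y" by simp
next
  fix c :: real and x :: 'a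
  let ?I = "\<lambda>x. INF p\<in>C. p x"
  assume c: "0 \<le> c"
  have eq: "(\<lambda>p. p (c *\<^sub>R x)) ` C = (\<lambda>p. c * p x) ` C"
    using sub c unfolding sublinear_def by (intro image_cong) auto
  show "?I (c *\<^sub>R x) = c * ?I x"
  proof (cases "c = 0")
    case True
    then show ?thesis unfolding eq using ne by simp
  next
    case False
    with c have c: "0 < c" by simp
    show ?thesis unfolding eq
    proof (rule antisym)
      have bd: "bdd_below ((\<lambda>p. c * p x) ` C)"
        using bdd[of "c *\<^sub>R x"] eq by simp
      have "(INF p\<in>C. c * p x) / c \<le> ?I x"
      proof (rule cINF_greatest[OF ne])
        fix p assume "p \<in> C"
        from cINF_lower[OF bd this] c show "(INF p\<in>C. c * p x) / c \<le> p x"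
          by (simp add: field_simps)
      qed
      then show "(INF p\<in>C. c * p x) \<le> c * ?I x" using c by (simp add: field_simps)
      show "c * ?I x \<le> (INF p\<in>C. c * p x)"
        by (rule cINF_greatest[OF ne]) (use c cINF_lower[OF bdd] in auto)
    qed
  qed
qed

lemma sublinear_shift:
  fixes x :: "'a::real_vector"
  assumes p: "sublinear p"
  defines "r \<equiv> \<lambda>y. INF t\<in>{0..}. p (y + t *\<^sub>R x) - t * p x"
  shows "sublinear r" "\<And>y t. 0 \<le> t \<Longrightarrow> r y \<le> p (y + t *\<^sub>R x) - t * p x"
proof -
  let ?f = "\<lambda>y t. p (y + t *\<^sub>R x) - t * p x"
  have padd: "p (u + v) \<le> p u + p v" and pscale: "0 \<le> c \<Longrightarrow> p (c *\<^sub>R u) = c * p u" for u v c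
    using p unfolding sublinear_def by blast+
  have lb: "- p (- y) \<le> ?f y t" if "0 \<le> t" for y t
    using padd[of "y + t *\<^sub>R x" "- y"] pscale[OF that, of x] by simp
  have bdd: "bdd_below (?f y ` {0..})" for y
    using lb by (auto simp: bdd_below_def)
  show low: "r y \<le> ?f y t" if "0 \<le> t" for y t
    unfolding r_def using that by (intro cINF_lower bdd) auto
  have ne: "{0::real..} \<noteq> {}" by auto
  show "sublinear r"
    unfolding sublinear_def
  proof (intro conjI allI impI)
    fix y z
    have *: "r (y + z) \<le> ?f y s + ?f z t" if "0 \<le> s" "0 \<le> t" for s t
      using low[of "s + t" "y + z"] padd[of "y + s *\<^sub>R x" "z + t *\<^sub>R x"] that
      by (simp add: algebra_simps)
    have "r (y + z) - ?f z t \<le> r y" if "0 \<le> t" for t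
      unfolding r_def[of] by (rule cINF_greatest[OF ne]) (use *[OF _ that] in \<open>simp add: r_def algebra_simps\<close>)
    then have "r (y + z) - r y \<le> ?f z t" if "0 \<le> t" for t
      using that by (smt (verit))
    then have "r (y + z) - r y \<le> r z"
      by (subst (3) r_def) (rule cINF_greatest[OF ne], simp)
    then show "r (y + z) \<le> r y + r z" by simp
  next
    fix c :: real and y
    assume c: "0 \<le> c"
    show "r (c *\<^sub>R y) = c * r y"
    proof (cases "c = 0")
      case True
      have "?f 0 ` {0..} = {0}" using pscale[of _ x] by (auto simp: image_iff)
      with True show ?thesis by (simp add: r_def)
    next
      case False
      with c have c: "0 < c" by simp
      have 1: "r (c *\<^sub>R y) \<le> c * r y" if c: "0 < c" for c y
      proof -
        have "r (c *\<^sub>R y) / c \<le> r y"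
        proof (subst (2) r_def, rule cINF_greatest[OF ne])
          fix t :: real assume t: "t \<in> {0..}"
          have "r (c *\<^sub>R y) \<le> ?f (c *\<^sub>R y) (c * t)" using t c by (intro low) auto
          also have "\<dots> = c * ?f y t"
            using pscale[of c "y + t *\<^sub>R x"] c by (simp add: algebra_simps)
          finally show "r (c *\<^sub>R y) / c \<le> ?f y t" using c by (simp add: field_simps)
        qed
        then show ?thesis using c by (simp add: field_simps)
      qed
      have "r y \<le> inverse c * r (c *\<^sub>R y)" using 1[of "inverse c" "c *\<^sub>R y"] c by simp
      then have "c * r y \<le> r (c *\<^sub>R y)" using c by (simp add: field_simps)
      with 1[OF c, of y] show ?thesis by simp
    qed
  qed
qed

lemma linear_below_sublinear:
  fixes q :: "'a::real_vector \<Rightarrow> real"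
  assumes q: "sublinear q"
  shows "\<exists>f. linear f \<and> (\<forall>x. f x \<le> q x)"
proof -
  define A where "A = {p. sublinear p \<and> (\<forall>x. p x \<le> q x)}"
  define P where "P = (\<lambda>f g :: 'a \<Rightarrow> real. \<forall>x. g x \<le> f x)"
  have "\<exists>m\<in>A. \<forall>a\<in>A. P m a \<longrightarrow> a = m"
  proof (rule predicate_Zorn)
    show "partial_order_on A (relation_of P A)"
      unfolding partial_order_on_def preorder_on_def relation_of_def refl_on_def trans_def antisym_def P_def
      by (auto intro: order_trans) (meson antisym ext)
  next
    fix C assume C: "C \<in> Chains (relation_of P A)"
    then have CA: "C \<subseteq> A" and chain: "\<And>f g. f \<in> C \<Longrightarrow> g \<in> C \<Longrightarrow> P f g \<or> P g f"
      by (auto simp: Chains_def relation_of_def)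
    show "\<exists>u\<in>A. \<forall>a\<in>C. P a u"
    proof (cases "C = {}")
      case True
      then show ?thesis using q by (auto simp: A_def)
    next
      case False
      have "- q (- x) \<le> p x" if "p \<in> C" for p x
        using that CA sublinear_lower[of p x] unfolding A_def
        by (smt (verit) mem_Collect_eq subsetD)
      then have bdd: "bdd_below ((\<lambda>p. p x) ` C)" for x
        by (auto simp: bdd_below_def)
      define u where "u x = (INF p\<in>C. p x)" for x
      have low: "u x \<le> p x" if "p \<in> C" for p x
        unfolding u_def using that by (rule cINF_lower[OF bdd])
      have "sublinear (\<lambda>x. INF p\<in>C. p x)"
      proof (rule sublinear_INF[OF False _ bdd])
        show "sublinear p" if "p \<in> C" for p using that CA by (auto simp: A_def)
        fix p r x y assume pr: "p \<in> C" "r \<in> C"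
        then have *: "p (x + y) \<le> p x + p y" "r (x + y) \<le> r x + r y"
          using CA unfolding A_def sublinear_def by blast+
        from chain[OF pr] show "\<exists>s\<in>C. s (x + y) \<le> p x + r y"
        proof
          assume "P p r" then have "r (x + y) \<le> p x + r y"
            using * unfolding P_def by (meson add_right_mono order_trans)
          with pr show ?thesis by blast
        next
          assume "P r p" then have "p (x + y) \<le> p x + r y"
            using * unfolding P_def by (meson add_left_mono order_trans)
          with pr show ?thesis by blast
        qed
      qed
      moreover have "u x \<le> q x" for x
        using False CA low unfolding A_def by (metis (mono_tags, lifting) all_not_in_conv mem_Collect_eq order_trans subsetD)
      ultimately have "u \<in> A" unfolding A_def u_def by simp
      with low show ?thesis unfolding P_def by blast
    qed
  qed
  then obtain f where f: "f \<in> A" and min: "\<And>g. g \<in> A \<Longrightarrow> P f g \<Longrightarrow> g = f" by blast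
  have sub: "sublinear f" and fq: "\<And>x. f x \<le> q x" using f by (auto simp: A_def)
  have fadd: "f (u + v) \<le> f u + f v" and fscale: "0 \<le> c \<Longrightarrow> f (c *\<^sub>R u) = c * f u" for u v c
    using sub unfolding sublinear_def by blast+
  have super: "f y + f x \<le> f (y + x)" for x y
  proof -
    define r where "r = (\<lambda>y. INF t\<in>{0..}. f (y + t *\<^sub>R x) - t * f x)"
    have r: "sublinear r" "\<And>y t. 0 \<le> t \<Longrightarrow> r y \<le> f (y + t *\<^sub>R x) - t * f x"
      unfolding r_def using sublinear_shift[OF sub] by blast+
    have rf: "r y \<le> f y" for y using r(2)[of 0 y] by simp
    then have "r \<in> A" "P f r" using r(1) fq order_trans unfolding A_def P_def by blast+
    then have "r = f" by (rule min)
    then show ?thesis using r(2)[of 1 y] by simp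
  qed
  have add: "f (x + y) = f x + f y" for x y using fadd super by (simp add: antisym)
  have f0: "f 0 = 0" using fscale[of 0 0] by simp
  have neg: "f (- x) = - f x" for x using add[of x "- x"] f0 by simp
  have "linear f"
  proof (rule linearI)
    show "f (x + y) = f x + f y" for x y by (rule add)
    show "f (c *\<^sub>R x) = c *\<^sub>R f x" for c x
    proof (cases "0 \<le> c")
      case False
      then have "f ((- c) *\<^sub>R x) = (- c) * f x" by (intro fscale) simp
      then show ?thesis using neg[of "c *\<^sub>R x"] by simp
    qed (simp add: fscale)
  qed
  with fq show ?thesis by blast
qed

lemma norming_functional:
  fixes x :: "'a::real_normed_vector"
  shows "\<exists>f::'a \<Rightarrow>\<^sub>L real. norm f \<le> 1 \<and> blinfun_apply f x = norm x"
proof -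
  have sub: "sublinear (norm :: 'a \<Rightarrow> real)"
    by (auto simp: sublinear_def norm_triangle_ineq)
  define r where "r = (\<lambda>y. INF t\<in>{0..}. norm (y + t *\<^sub>R x) - t * norm x)"
  have r: "sublinear r" "\<And>y t. 0 \<le> t \<Longrightarrow> r y \<le> norm (y + t *\<^sub>R x) - t * norm x"
    unfolding r_def using sublinear_shift[OF sub] by blast+
  obtain f where f: "linear f" "\<And>y. f y \<le> r y" using linear_below_sublinear[OF r(1)] by blast
  interpret linear f by fact
  have fn: "f y \<le> norm y" for y using f(2)[of y] r(2)[of 0 y] by simp
  have abs: "\<bar>f y\<bar> \<le> norm y" for y using fn[of y] fn[of "- y"] by (simp add: neg)
  have bl: "bounded_linear f"
    by (rule bounded_linear_intro[of _ 1]) (use abs in \<open>auto simp: add scale\<close>)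
  have "f x = norm x"
    using f(2)[of "- x"] r(2)[of 1 "- x"] fn[of x] by (simp add: neg)
  moreover have "norm (Blinfun f) \<le> 1"
    by (rule norm_blinfun_bound) (use abs in \<open>auto simp: bounded_linear_Blinfun_apply[OF bl]\<close>)
  ultimately show ?thesis
    by (intro exI[of _ "Blinfun f"]) (simp add: bounded_linear_Blinfun_apply[OF bl])
qed

lemma separating_functional:
  fixes x :: "'a::real_normed_vector"
  assumes "finite S" "x \<notin> span S"
  shows "\<exists>f::'a \<Rightarrow> real. bounded_linear f \<and> (\<forall>s\<in>S. f s = 0) \<and> f x = 1"
  using assms
proof (induction S arbitrary: x)
  case empty
  then have x: "norm x \<noteq> 0" by simp
  obtain f :: "'a \<Rightarrow>\<^sub>L real" where f: "blinfun_apply f x = norm x" using norming_functional by blast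
  have "bounded_linear (\<lambda>y. blinfun_apply f y / norm x)"
    by (intro bounded_linear_divide blinfun.bounded_linear_right bounded_linear_compose[OF bounded_linear_divide])
  with f x show ?case by (intro exI[of _ "\<lambda>y. blinfun_apply f y / norm x"]) simp
next
  case (insert s T)
  have xT: "x \<notin> span T" using insert.prems span_mono[of T "insert s T"] by blast
  show ?case
  proof (cases "s \<in> span T")
    case True
    obtain f :: "'a \<Rightarrow> real" where f: "bounded_linear f" "\<forall>s\<in>T. f s = 0" "f x = 1"
      using insert.IH[OF xT] by blast
    have "f s = 0"
      using linear_eq_0_on_span[OF bounded_linear.linear[OF f(1)] _ True] f(2) by blast
    with f show ?thesis by auto
  next
    case False
    obtain g :: "'a \<Rightarrow> real" where g: "bounded_linear g" "\<forall>s\<in>T. g s = 0" "g s = 1"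
      using insert.IH[OF False] by blast
    have "x - g x *\<^sub>R s \<notin> span T"
      using insert.prems by (auto simp: span_insert)
    then obtain k :: "'a \<Rightarrow> real" where
      k: "bounded_linear k" "\<forall>s\<in>T. k s = 0" "k (x - g x *\<^sub>R s) = 1"
      using insert.IH by blast
    have kx: "k x - g x * k s = 1"
      using k(3) by (simp add: linear_diff linear_scale bounded_linear.linear[OF k(1)])
    have "bounded_linear (\<lambda>y. k y - k s * g y)"
      by (intro bounded_linear_sub k(1) bounded_linear_const_mult g(1))
    then show ?thesis
      by (intro exI[of _ "\<lambda>y. k y - k s * g y"]) (use g k kx in \<open>auto simp: mult.commute\<close>)
  qed
qed

lemma bilinear_forms_separate:
  fixes xs :: "('a::real_normed_vector \<times> 'b::real_normed_vector) list"
  assumes "\<And>(f::'a \<Rightarrow> real) (g::'b \<Rightarrow> real). bounded_linear f \<Longrightarrow> bounded_linear g \<Longrightarrow>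
             (\<Sum>(x, y)\<leftarrow>xs. f x * g y) = 0"
  shows "tensor_sum xs = 0"
  using assms
proof (induction "length xs" arbitrary: xs)
  case 0
  then show ?case by simp
next
  case (Suc n)
  then obtain x y zs where xs: "xs = (x, y) # zs" and n: "n = length zs"
    by (metis Suc_length_conv surj_pair)
  have hyp: "f x * g y + (\<Sum>(x, y)\<leftarrow>zs. f x * g y) = 0"
    if "bounded_linear f" "bounded_linear g" for f :: "'a \<Rightarrow> real" and g :: "'b \<Rightarrow> real"
    using Suc.prems[OF that] by (simp add: xs)
  show ?case
  proof (cases "x \<in> span (fst ` set zs)")
    case False
    obtain f :: "'a \<Rightarrow> real" where f: "bounded_linear f" "\<forall>s\<in>fst ` set zs. f s = 0" "f x = 1"
      using separating_functional[OF _ False] by auto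
    have f0: "(\<Sum>(x, y)\<leftarrow>zs. f x * g y) = 0" for g :: "'b \<Rightarrow> real"
      using f(2) by (induction zs) auto
    obtain g :: "'b \<Rightarrow>\<^sub>L real" where g: "blinfun_apply g y = norm y" using norming_functional by blast
    have "y = 0" using hyp[OF f(1), of "blinfun_apply g"] f0[of "blinfun_apply g"] f(3) g
      by (simp add: blinfun.bounded_linear_right)
    moreover have "tensor_sum zs = 0"
    proof (rule Suc.hyps(1)[OF n])
      fix f :: "'a \<Rightarrow> real" and g :: "'b \<Rightarrow> real"
      assume fg: "bounded_linear f" "bounded_linear g"
      from hyp[OF fg] linear_0[OF bounded_linear.linear[OF fg(2)]] \<open>y = 0\<close>
      show "(\<Sum>(x, y)\<leftarrow>zs. f x * g y) = 0" by simp
    qed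
    ultimately show ?thesis by (simp add: xs)
  next
    case True
    have "\<exists>c. x = (\<Sum>(c, z)\<leftarrow>zip c (map fst zs). c *\<^sub>R z) \<and> length c = length zs"
      using True
    proof (induction zs arbitrary: x)
      case Nil
      then show ?case by simp
    next
      case (Cons z zs)
      then obtain k where "x - k *\<^sub>R fst z \<in> span (fst ` set zs)" by (auto simp: span_insert)
      from Cons.IH[OF this] obtain c where
        "x - k *\<^sub>R fst z = (\<Sum>(c, z)\<leftarrow>zip c (map fst zs). c *\<^sub>R z)" "length c = length zs" by blast
      then show ?case by (intro exI[of _ "k # c"]) (auto simp: algebra_simps)
    qed
    then obtain c where c: "x = (\<Sum>(c, z)\<leftarrow>zip c (map fst zs). c *\<^sub>R z)" "length c = length zs" by blast
    define ws where "ws = map (\<lambda>(c, (x', y')). (x', y' + c *\<^sub>R y)) (zip c zs)"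
    have T: "B x y + (\<Sum>(x, y)\<leftarrow>zs. B x y) = (\<Sum>(x, y)\<leftarrow>ws. B x y)"
      if "bilinear B" for B :: "'a \<Rightarrow> 'b \<Rightarrow> 'c::real_vector"
    proof -
      have "B (\<Sum>(c, z)\<leftarrow>zip c (map fst zs). c *\<^sub>R z) y + (\<Sum>(x, y)\<leftarrow>zs. B x y) =
          (\<Sum>(x, y)\<leftarrow>map (\<lambda>(c, (x', y')). (x', y' + c *\<^sub>R y)) (zip c zs). B x y)"
        using c(2)
        by (induction c zs rule: list_induct2)
           (auto simp: bilinear_lzero[OF that] bilinear_ladd[OF that] bilinear_radd[OF that]
             bilinear_lmul[OF that] bilinear_rmul[OF that] algebra_simps)
      then show ?thesis using c(1) by (simp add: ws_def)
    qed
    have "tensor_sum ws = 0"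
    proof (rule Suc.hyps(1))
      show "n = length ws" using c n by (simp add: ws_def)
      fix f :: "'a \<Rightarrow> real" and g :: "'b \<Rightarrow> real"
      assume fg: "bounded_linear f" "bounded_linear g"
      have "bilinear (\<lambda>x y. f x * g y)"
        using linear_add[OF bounded_linear.linear[OF fg(1)]] linear_scale[OF bounded_linear.linear[OF fg(1)]]
          linear_add[OF bounded_linear.linear[OF fg(2)]] linear_scale[OF bounded_linear.linear[OF fg(2)]]
        unfolding bilinear_def by (auto intro!: linearI simp: algebra_simps)
      from T[OF this] hyp[OF fg] show "(\<Sum>(x, y)\<leftarrow>ws. f x * g y) = 0" by simp
    qed
    then show ?thesis using T[OF bilinear_tensor] by (simp add: xs)
  qed
qed

section \<open>The projective norm\<close>

definition projective_norm :: "('a::real_normed_vector, 'b::real_normed_vector) tensor \<Rightarrow> real" where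
  "projective_norm u =
     Inf {\<Sum>(x, y)\<leftarrow>xs. norm x * norm y | xs. u = (\<Sum>(x, y)\<leftarrow>xs. x \<otimes> y)}"

abbreviation cost :: "('a::real_normed_vector \<times> 'b::real_normed_vector) list \<Rightarrow> real" where
  "cost xs \<equiv> (\<Sum>(x, y)\<leftarrow>xs. norm x * norm y)"

lemma cost_nonneg: "0 \<le> cost xs"
  by (induction xs) auto

lemma projective_norm_le: "projective_norm (tensor_sum xs) \<le> cost xs"
  unfolding projective_norm_def
proof (rule cInf_lower)
  show "bdd_below {cost ys | ys. tensor_sum xs = tensor_sum ys}"
    by (rule bdd_belowI[of _ 0]) (use cost_nonneg in blast)
qed blast

lemma projective_norm_greatest:
  assumes "\<And>xs. u = tensor_sum xs \<Longrightarrow> b \<le> cost xs"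
  shows "b \<le> projective_norm u"
  unfolding projective_norm_def
proof (rule cInf_greatest)
  show "{cost xs | xs. u = tensor_sum xs} \<noteq> {}"
    using tensor_sum_exists[of u] by blast
qed (use assms in blast)

lemma projective_norm_nonneg: "0 \<le> projective_norm u"
  by (rule projective_norm_greatest) (rule cost_nonneg)

lemma projective_norm_triangle: "projective_norm (u + v) \<le> projective_norm u + projective_norm v"
proof -
  have 1: "projective_norm (u + v) \<le> cost xs + cost ys" if "u = tensor_sum xs" "v = tensor_sum ys" for xs ys
    using projective_norm_le[of "xs @ ys"] that by simp
  have 2: "projective_norm (u + v) - cost ys \<le> projective_norm u" if "v = tensor_sum ys" for ys
    by (rule projective_norm_greatest) (use 1[OF _ that] in \<open>simp add: algebra_simps\<close>)
  have "projective_norm (u + v) - projective_norm u \<le> projective_norm v"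
    by (rule projective_norm_greatest) (use 2 in \<open>simp add: algebra_simps\<close>)
  then show ?thesis by simp
qed

lemma projective_norm_zero: "projective_norm 0 = 0"
  by (rule antisym) (use projective_norm_le[of "[]"] projective_norm_nonneg in auto)

lemma projective_norm_scaleR: "projective_norm (c *\<^sub>R u) = \<bar>c\<bar> * projective_norm u"
proof -
  have le: "projective_norm (c *\<^sub>R u) \<le> \<bar>c\<bar> * projective_norm u" if c: "c \<noteq> 0" for c u
  proof -
    have "projective_norm (c *\<^sub>R u) / \<bar>c\<bar> \<le> projective_norm u"
    proof (rule projective_norm_greatest)
      fix xs assume u: "u = tensor_sum xs"
      have "cost (map (\<lambda>(x, y). (c *\<^sub>R x, y)) xs) = \<bar>c\<bar> * cost xs"
        by (induction xs) (auto simp: algebra_simps)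
      with projective_norm_le[of "map (\<lambda>(x, y). (c *\<^sub>R x, y)) xs"]
      have "projective_norm (c *\<^sub>R u) \<le> \<bar>c\<bar> * cost xs"
        by (simp only: u scaleR_tensor_sum)
      then show "projective_norm (c *\<^sub>R u) / \<bar>c\<bar> \<le> cost xs" using c by (simp add: field_simps)
    qed
    then show ?thesis using c by (simp add: field_simps)
  qed
  show ?thesis
  proof (cases "c = 0")
    case True
    then show ?thesis by (simp add: projective_norm_zero)
  next
    case False
    have "projective_norm u \<le> \<bar>inverse c\<bar> * projective_norm (c *\<^sub>R u)"
      using le[of "inverse c" "c *\<^sub>R u"] False by simp
    then have "\<bar>c\<bar> * projective_norm u \<le> projective_norm (c *\<^sub>R u)"
      using False by (simp add: field_simps)
    with le[OF False] show ?thesis by (rule antisym)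
  qed
qed

lemma projective_norm_definite:
  assumes "projective_norm u = 0"
  shows "u = 0"
proof -
  obtain xs where u: "u = tensor_sum xs" using tensor_sum_exists by blast
  have "tensor_sum xs = 0"
  proof (rule bilinear_forms_separate)
    fix f :: "'a \<Rightarrow> real" and g :: "'b \<Rightarrow> real"
    assume f: "bounded_linear f" and g: "bounded_linear g"
    interpret f: bounded_linear f by fact
    interpret g: bounded_linear g by fact
    obtain K where K: "0 < K" "\<And>x. norm (f x) \<le> norm x * K" using f.pos_bounded by blast
    obtain L where L: "0 < L" "\<And>x. norm (g x) \<le> norm x * L" using g.pos_bounded by blast
    have "bilinear (\<lambda>x y. f x * g y)"
      unfolding bilinear_def
      by (auto intro!: linearI simp: f.add g.add f.scale g.scale algebra_simps)
    then obtain T where T: "linear T" "\<And>x y. T (x \<otimes> y) = f x * g y"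
      using tensor_universal[of "\<lambda>x y. f x * g y"] by blast
    have Tsum: "T (tensor_sum zs) = (\<Sum>(x, y)\<leftarrow>zs. f x * g y)" for zs
      by (induction zs) (auto simp: linear_0[OF T(1)] linear_add[OF T(1)] T(2))
    have "\<bar>T u\<bar> / (K * L) \<le> projective_norm u"
    proof (rule projective_norm_greatest)
      fix zs assume zs: "u = tensor_sum zs"
      have "\<bar>\<Sum>(x, y)\<leftarrow>zs. f x * g y\<bar> \<le> (K * L) * cost zs"
      proof (induction zs)
        case (Cons z zs)
        obtain x y where z: "z = (x, y)" by fastforce
        have "\<bar>f x * g y\<bar> \<le> (norm x * K) * (norm y * L)"
          unfolding abs_mult by (rule mult_mono) (use K(2)[of x] L(2)[of y] K(1) in auto)
        also have "\<dots> = (K * L) * (norm x * norm y)" by simp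
        finally have "\<bar>f x * g y + (\<Sum>(x, y)\<leftarrow>zs. f x * g y)\<bar> \<le> (K * L) * (norm x * norm y) + (K * L) * cost zs"
          using Cons.IH by linarith
        then show ?case by (simp add: z distrib_left)
      qed simp
      then show "\<bar>T u\<bar> / (K * L) \<le> cost zs"
        unfolding zs Tsum using K(1) L(1) by (simp add: pos_divide_le_eq mult.commute)
    qed
    moreover have "0 < K * L" using K(1) L(1) by simp
    ultimately have "T u = 0" using assms by (auto simp: divide_le_0_iff)
    then show "(\<Sum>(x, y)\<leftarrow>xs. f x * g y) = 0" by (simp add: u Tsum)
  qed
  with u show ?thesis by simp
qed

instantiation tensor :: (real_normed_vector, real_normed_vector) real_normed_vector
begin

definition norm_tensor :: "('a, 'b) tensor \<Rightarrow> real" where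
  "norm_tensor = projective_norm"

definition dist_tensor :: "('a, 'b) tensor \<Rightarrow> ('a, 'b) tensor \<Rightarrow> real" where
  "dist_tensor u v = norm (u - v)"

definition sgn_tensor :: "('a, 'b) tensor \<Rightarrow> ('a, 'b) tensor" where
  "sgn_tensor u = inverse (norm u) *\<^sub>R u"

definition uniformity_tensor :: "(('a, 'b) tensor \<times> ('a, 'b) tensor) filter" where
  [code del]: "uniformity_tensor = (INF e\<in>{0 <..}. principal {(x, y). dist x y < e})"

definition open_tensor :: "('a, 'b) tensor set \<Rightarrow> bool" where
  [code del]: "open_tensor S = (\<forall>x\<in>S. \<forall>\<^sub>F (x', y) in uniformity. x' = x \<longrightarrow> y \<in> S)"

instance
proof
  fix u v :: "('a, 'b) tensor" and c :: real
  show "norm u = 0 \<longleftrightarrow> u = 0"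
    unfolding norm_tensor_def using projective_norm_definite projective_norm_zero by blast
  show "norm (u + v) \<le> norm u + norm v"
    unfolding norm_tensor_def by (rule projective_norm_triangle)
  show "norm (c *\<^sub>R u) = \<bar>c\<bar> * norm u"
    unfolding norm_tensor_def by (rule projective_norm_scaleR)
qed (rule dist_tensor_def sgn_tensor_def uniformity_tensor_def open_tensor_def)+

end

section \<open>Completion of a normed space\<close>

text \<open>The closure of the canonical image of the space in its bidual, which is a Banach space;
  the facts \<open>norm_completion_embed\<close> and \<open>completion_embed_dense\<close> below show that this is the
  completion (unique up to isometric isomorphism).\<close>

definition bidual_embed :: "'a::real_normed_vector \<Rightarrow> (('a \<Rightarrow>\<^sub>L real) \<Rightarrow>\<^sub>L real)" where
  "bidual_embed x = Blinfun (\<lambda>f. blinfun_apply f x)"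

lemma bidual_embed_apply [simp]: "blinfun_apply (bidual_embed x) f = blinfun_apply f x"
  unfolding bidual_embed_def
  by (simp add: bounded_linear_Blinfun_apply blinfun.bounded_linear_left)

lemma linear_bidual_embed: "linear bidual_embed"
  by (rule linearI) (auto intro!: blinfun_eqI simp: blinfun.bilinear_simps)

lemma norm_bidual_embed: "norm (bidual_embed x) = norm x"
proof (rule antisym)
  show "norm (bidual_embed x) \<le> norm x"
  proof (rule norm_blinfun_bound)
    show "norm (blinfun_apply (bidual_embed x) f) \<le> norm x * norm f" for f
      using norm_blinfun[of f x] by (simp add: mult.commute)
  qed simp
  obtain f :: "'a \<Rightarrow>\<^sub>L real" where f: "norm f \<le> 1" "blinfun_apply f x = norm x"
    using norming_functional by blast
  have "norm x \<le> norm (bidual_embed x) * norm f"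
    using norm_blinfun[of "bidual_embed x" f] f(2) by simp
  also have "\<dots> \<le> norm (bidual_embed x)"
    using f(1) by (simp add: mult_left_le)
  finally show "norm x \<le> norm (bidual_embed x)" .
qed

lemma subspace_closure:
  fixes S :: "'a::real_normed_vector set"
  assumes S: "subspace S"
  shows "subspace (closure S)"
  unfolding subspace_def
proof (intro conjI ballI allI)
  show "0 \<in> closure S"
    using subspace_0[OF S] closure_subset by blast
next
  fix x y assume "x \<in> closure S" "y \<in> closure S"
  then obtain X Y where X: "\<forall>n. X n \<in> S" "X \<longlonglongrightarrow> x" and Y: "\<forall>n. Y n \<in> S" "Y \<longlonglongrightarrow> y"
    unfolding closure_sequential by (elim exE conjE)
  have "\<forall>n. X n + Y n \<in> S" using X(1) Y(1) subspace_add[OF S] by simp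
  with tendsto_add[OF X(2) Y(2)] show "x + y \<in> closure S"
    unfolding closure_sequential by (intro exI[of _ "\<lambda>n. X n + Y n"]) simp
next
  fix c and x assume "x \<in> closure S"
  then obtain X where X: "\<forall>n. X n \<in> S" "X \<longlonglongrightarrow> x"
    unfolding closure_sequential by (elim exE conjE)
  have "\<forall>n. c *\<^sub>R X n \<in> S" using X(1) subspace_scale[OF S] by simp
  with tendsto_scaleR[OF tendsto_const X(2)] show "c *\<^sub>R x \<in> closure S"
    unfolding closure_sequential by (intro exI[of _ "\<lambda>n. c *\<^sub>R X n"]) simp
qed

lemma subspace_closure_bidual: "subspace (closure (range bidual_embed))"
  by (intro subspace_closure linear_subspace_image[OF linear_bidual_embed] subspace_UNIV)

typedef (overloaded) 'a completion =
  "closure (range bidual_embed) :: (('a::real_normed_vector \<Rightarrow>\<^sub>L real) \<Rightarrow>\<^sub>L real) set"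
  using subspace_0[OF subspace_closure_bidual] by blast

setup_lifting type_definition_completion

instantiation completion :: (real_normed_vector) real_normed_vector
begin

lift_definition zero_completion :: "'a completion" is 0
  by (rule subspace_0[OF subspace_closure_bidual])

lift_definition plus_completion :: "'a completion \<Rightarrow> 'a completion \<Rightarrow> 'a completion" is "(+)"
  by (rule subspace_add[OF subspace_closure_bidual])

lift_definition uminus_completion :: "'a completion \<Rightarrow> 'a completion" is uminus
  by (rule subspace_neg[OF subspace_closure_bidual])

lift_definition minus_completion :: "'a completion \<Rightarrow> 'a completion \<Rightarrow> 'a completion" is "(-)"
  by (rule subspace_diff[OF subspace_closure_bidual])

lift_definition scaleR_completion :: "real \<Rightarrow> 'a completion \<Rightarrow> 'a completion" is scaleR
  by (rule subspace_scale[OF subspace_closure_bidual])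

lift_definition norm_completion :: "'a completion \<Rightarrow> real" is norm .

definition dist_completion :: "'a completion \<Rightarrow> 'a completion \<Rightarrow> real" where
  "dist_completion x y = norm (x - y)"

definition sgn_completion :: "'a completion \<Rightarrow> 'a completion" where
  "sgn_completion x = inverse (norm x) *\<^sub>R x"

definition uniformity_completion :: "('a completion \<times> 'a completion) filter" where
  [code del]: "uniformity_completion = (INF e\<in>{0 <..}. principal {(x, y). dist x y < e})"

definition open_completion :: "'a completion set \<Rightarrow> bool" where
  [code del]: "open_completion S = (\<forall>x\<in>S. \<forall>\<^sub>F (x', y) in uniformity. x' = x \<longrightarrow> y \<in> S)"

instance
proof
  fix x y z :: "'a completion" and c d :: real
  show "x + y + z = x + (y + z)" by transfer (rule add.assoc)
  show "x + y = y + x" by transfer (rule add.commute)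
  show "0 + x = x" by transfer (rule add_0_left)
  show "- x + x = 0" by transfer (rule left_minus)
  show "x - y = x + - y" by transfer (rule diff_conv_add_uminus)
  show "c *\<^sub>R (x + y) = c *\<^sub>R x + c *\<^sub>R y" by transfer (rule scaleR_add_right)
  show "(c + d) *\<^sub>R x = c *\<^sub>R x + d *\<^sub>R x" by transfer (rule scaleR_add_left)
  show "c *\<^sub>R d *\<^sub>R x = (c * d) *\<^sub>R x" by transfer (rule scaleR_scaleR)
  show "1 *\<^sub>R x = x" by transfer (rule scaleR_one)
  show "norm (x + y) \<le> norm x + norm y" by transfer (rule norm_triangle_ineq)
  show "norm x = 0 \<longleftrightarrow> x = 0" by transfer (rule norm_eq_zero)
  show "norm (c *\<^sub>R x) = \<bar>c\<bar> * norm x" by transfer (rule norm_scaleR)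
qed (rule dist_completion_def sgn_completion_def uniformity_completion_def open_completion_def)+

end

lemma dist_Rep_completion: "dist (Rep_completion x) (Rep_completion y) = dist x y"
  by (simp add: dist_norm norm_completion.rep_eq minus_completion.rep_eq)

instance completion :: (real_normed_vector) banach
proof
  fix X :: "nat \<Rightarrow> 'a completion"
  assume "Cauchy X"
  then have "Cauchy (\<lambda>n. Rep_completion (X n))"
    by (simp add: Cauchy_def dist_Rep_completion)
  then obtain L where L: "(\<lambda>n. Rep_completion (X n)) \<longlonglongrightarrow> L"
    by (auto simp: Cauchy_convergent_iff convergent_def)
  have "L \<in> closure (range bidual_embed)"
    using closed_sequentially[OF closed_closure _ L] Rep_completion by blast
  then have "Rep_completion (Abs_completion L) = L" by (rule Abs_completion_inverse)
  with L have "X \<longlonglongrightarrow> Abs_completion L"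
    by (simp add: lim_sequentially flip: dist_Rep_completion)
  then show "convergent X" by (rule convergentI)
qed

lift_definition completion_embed :: "'a::real_normed_vector \<Rightarrow> 'a completion" is bidual_embed
  by (rule subsetD[OF closure_subset rangeI])

lemma linear_completion_embed: "linear completion_embed"
proof (rule linearI)
  show "completion_embed (x + y) = completion_embed x + completion_embed y" for x y :: 'a
    by (simp add: Rep_completion_inject[symmetric] completion_embed.rep_eq plus_completion.rep_eq
        linear_add[OF linear_bidual_embed])
  show "completion_embed (c *\<^sub>R x) = c *\<^sub>R completion_embed x" for c and x :: 'a
    by (simp add: Rep_completion_inject[symmetric] completion_embed.rep_eq scaleR_completion.rep_eq
        linear_scale[OF linear_bidual_embed])
qed

lemma norm_completion_embed: "norm (completion_embed x) = norm x"
  by (simp add: norm_completion.rep_eq completion_embed.rep_eq norm_bidual_embed)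

lemma completion_embed_dense: "closure (range completion_embed) = UNIV"
proof (intro set_eqI iffI UNIV_I)
  fix z :: "'a completion"
  show "z \<in> closure (range completion_embed)"
    unfolding closure_approachable
  proof (intro allI impI)
    fix e :: real assume "0 < e"
    then obtain x where "dist (bidual_embed x) (Rep_completion z) < e"
      using Rep_completion[of z] unfolding closure_approachable by blast
    then show "\<exists>y\<in>range completion_embed. dist y z < e"
      by (auto simp flip: dist_Rep_completion completion_embed.rep_eq)
  qed
qed

type_synonym ('a, 'b) projective_tensor = "('a, 'b) tensor completion"

section \<open>The ball dentable property\<close>

definition slice :: "('a::real_normed_vector \<Rightarrow>\<^sub>L real) \<Rightarrow> real \<Rightarrow> 'a set" where
  "slice f \<alpha> = {z \<in> cball 0 1. blinfun_apply f z > 1 - \<alpha>}"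

definition BDP :: "'a::real_normed_vector itself \<Rightarrow> bool" where
  "BDP TYPE('a) \<longleftrightarrow>
     (\<forall>\<epsilon>>0. \<exists>(f :: 'a \<Rightarrow>\<^sub>L real) \<alpha>.
        norm f = 1 \<and> 0 < \<alpha> \<and> \<alpha> < 1 \<and> diameter (slice f \<alpha>) < \<epsilon>)"

end

theory Submission
  imports Defs
begin

text \<open>
  Everything rests on one principle: the unit ball of the projective tensor product \<open>Z\<close> of \<open>X\<close>
  and \<open>Y\<close> is the closed convex hull of the elementary tensors of unit vectors.  In the dual form
  used here (\<open>subadditive_le_projective_norm\<close>), a continuous subadditive function that vanishes
  at 0 and is bounded by \<open>K * (norm x * norm y)\<close> on elementary tensors, with \<open>K\<close> nonnegative, is
  bounded by \<open>K * norm z\<close> on all of \<open>Z\<close>.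

  If \<open>Z\<close> has a slice of small diameter, given by a functional \<open>F\<close>, then by this principle the
  slice contains an elementary tensor of two unit vectors \<open>x0\<close> and \<open>y0\<close>.  Tensoring with \<open>y0\<close>
  embeds \<open>X\<close> isometrically in \<open>Z\<close>, so the slice pulls back to a slice of the ball of \<open>X\<close> that is
  no larger, and it is nonempty as it contains \<open>x0\<close>.  Tensoring with \<open>x0\<close> treats \<open>Y\<close>
  in the same way.

  Conversely, let \<open>f\<close> and \<open>g\<close> define slices of width \<open>\<alpha>\<close> and diameter at most \<open>\<delta>\<close> in the balls of
  \<open>X\<close> and \<open>Y\<close>, let \<open>e\<close> be the tensor of a point of the one slice with a point of the other, and
  let \<open>F\<close> be the norm-one functional on \<open>Z\<close> that is \<open>f x * g y\<close> on elementary tensors.  For unit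
  vectors, \<open>f x * g y\<close> close to 1 forces \<open>x\<close> and \<open>y\<close> (up to a common sign, which the tensor does
  not see) into the two slices, hence the tensor close to \<open>e\<close>; otherwise \<open>1 - f x * g y\<close> is at
  least \<open>\<alpha>\<close>.  Both cases are contained in the estimate
  \<open>norm (z - F z *\<^sub>R e) \<le> 2 * \<delta> * norm z + 2 / \<alpha> * (norm z - F z)\<close>
  for elementary tensors \<open>z\<close>.  With the term \<open>F z\<close> moved to the left it bounds a subadditive
  function by a multiple of the norm, so by the principle it holds for every \<open>z\<close>.  Thus \<open>F z\<close> close to 1 makes \<open>z\<close> close to \<open>e\<close>, and slices of \<open>F\<close> are
  small.
\<close>

section \<open>Elementary tensors and functionals on the projective tensor product\<close>

definition elementary ::
    "'a::real_normed_vector \<Rightarrow> 'b::real_normed_vector \<Rightarrow> ('a, 'b) projective_tensor"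
  (infix "\<otimes>\<^sub>\<pi>" 75) where
  "x \<otimes>\<^sub>\<pi> y = completion_embed (x \<otimes> y)"

lemma bilinear_elementary: "bilinear (\<otimes>\<^sub>\<pi>)"
  unfolding bilinear_def elementary_def
  by (auto intro!: linearI simp: tensor_add_left tensor_add_right tensor_scale_left
      tensor_scale_right linear_add[OF linear_completion_embed]
      linear_scale[OF linear_completion_embed])

lemma norm_elementary_le: "norm (x \<otimes>\<^sub>\<pi> y) \<le> norm x * norm y"
  using projective_norm_le[of "[(x, y)]"]
  by (simp add: elementary_def norm_completion_embed norm_tensor_def)

text \<open>
  A functional form of the description of the unit ball as a closed convex hull: along a
  representation of an algebraic tensor the bounds add up to \<open>K\<close> times its cost, the infimum over
  representations turns the cost into the norm, and density does the rest.
\<close>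

lemma subadditive_le_projective_norm:
  fixes \<phi> :: "('a::real_normed_vector, 'b::real_normed_vector) projective_tensor \<Rightarrow> real"
  assumes cont: "continuous_on UNIV \<phi>" and zero: "\<phi> 0 = 0"
    and add: "\<And>z w. \<phi> (z + w) \<le> \<phi> z + \<phi> w"
    and K: "0 \<le> K" and bound: "\<And>x y. \<phi> (x \<otimes>\<^sub>\<pi> y) \<le> K * (norm x * norm y)"
  shows "\<phi> z \<le> K * norm z"
proof -
  have cost: "\<phi> (completion_embed (tensor_sum xs)) \<le> K * cost xs" for xs
  proof (induction xs)
    case Nil
    then show ?case by (simp add: linear_0[OF linear_completion_embed] zero)
  next
    case (Cons p xs)
    obtain x y where p: "p = (x, y)" by fastforce
    have "\<phi> (completion_embed (tensor_sum (p # xs)))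
        \<le> \<phi> (x \<otimes>\<^sub>\<pi> y) + \<phi> (completion_embed (tensor_sum xs))"
      using add by (simp add: p linear_add[OF linear_completion_embed] elementary_def)
    also have "\<dots> \<le> K * (norm x * norm y) + K * cost xs"
      by (rule add_mono[OF bound Cons.IH])
    finally show ?case by (simp add: p distrib_left)
  qed
  have algebraic: "\<phi> (completion_embed u) \<le> K * norm u" for u
  proof (cases "K = 0")
    case True
    then show ?thesis using tensor_sum_exists[of u] cost by fastforce
  next
    case False
    with K have K: "0 < K" by simp
    have "\<phi> (completion_embed u) / K \<le> norm u"
      unfolding norm_tensor_def
    proof (rule projective_norm_greatest)
      fix xs assume "u = tensor_sum xs"
      with cost[of xs] K show "\<phi> (completion_embed u) / K \<le> cost xs"
        by (simp add: field_simps)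
    qed
    with K show ?thesis by (simp add: field_simps)
  qed
  have "closed {z. \<phi> z \<le> K * norm z}"
    by (intro closed_Collect_le cont continuous_intros)
  moreover have "range completion_embed \<subseteq> {z. \<phi> z \<le> K * norm z}"
    using algebraic by (auto simp: norm_completion_embed)
  ultimately have "closure (range completion_embed) \<subseteq> {z. \<phi> z \<le> K * norm z}"
    by (rule closure_minimal[rotated])
  then show ?thesis using completion_embed_dense by blast
qed

corollary norm_projective_functional_le:
  fixes F :: "('a::real_normed_vector, 'b::real_normed_vector) projective_tensor \<Rightarrow>\<^sub>L real"
  assumes "0 \<le> K" and bound: "\<And>x y. \<bar>F (x \<otimes>\<^sub>\<pi> y)\<bar> \<le> K * (norm x * norm y)"
  shows "norm F \<le> K"
proof (rule norm_blinfun_bound)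
  show "norm (F z) \<le> K * norm z" for z
  proof (rule subadditive_le_projective_norm)
    show "continuous_on UNIV (\<lambda>z. norm (F z))" by (intro continuous_intros)
    show "norm (F (z + w)) \<le> norm (F z) + norm (F w)" for z w
      unfolding blinfun.add_right by (rule norm_triangle_ineq)
  qed (use assms in auto)
qed fact

text \<open>
  A point of the completion is an element of the bidual, so a functional \<open>T\<close> extends by
  evaluating points of the completion at \<open>T\<close>.
\<close>

lemma completion_functional_extends:
  fixes T :: "'a::real_normed_vector \<Rightarrow>\<^sub>L real"
  shows "\<exists>F :: 'a completion \<Rightarrow>\<^sub>L real. \<forall>u. F (completion_embed u) = T u"
proof -
  have "bounded_linear (\<lambda>z :: 'a completion. Rep_completion z T)"
    by (rule bounded_linear_intro[of _ "norm T"])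
       (simp_all add: plus_completion.rep_eq scaleR_completion.rep_eq norm_completion.rep_eq
          blinfun.add_left blinfun.scaleR_left norm_blinfun flip: real_norm_def)
  then show ?thesis
    by (intro exI[of _ "Blinfun (\<lambda>z. Rep_completion z T)"])
       (simp add: bounded_linear_Blinfun_apply completion_embed.rep_eq)
qed

text \<open>
  The product of two functionals is a bounded bilinear form, which lifts to the algebraic tensor
  product and then to the completion.  The norm cannot drop below the product of the norms because
  \<open>norm F * norm x * norm y\<close> bounds \<open>\<bar>f x * g y\<bar>\<close>: the supremum over \<open>x\<close> gives \<open>norm f\<close>, then that
  over \<open>y\<close> gives \<open>norm g\<close>.
\<close>

lemma functional_product:
  fixes f :: "'a::real_normed_vector \<Rightarrow>\<^sub>L real" and g :: "'b::real_normed_vector \<Rightarrow>\<^sub>L real"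
  shows "\<exists>F :: ('a, 'b) projective_tensor \<Rightarrow>\<^sub>L real.
           (\<forall>x y. blinfun_apply F (x \<otimes>\<^sub>\<pi> y) = f x * g y) \<and> norm F = norm f * norm g"
proof -
  have bound: "\<bar>f x * g y\<bar> \<le> (norm f * norm g) * (norm x * norm y)" for x y
  proof -
    have "\<bar>f x * g y\<bar> \<le> (norm f * norm x) * (norm g * norm y)"
      unfolding abs_mult using norm_blinfun[of f x] norm_blinfun[of g y] by (intro mult_mono) auto
    then show ?thesis by (simp add: mult_ac)
  qed
  have "bilinear (\<lambda>x y. f x * g y)"
    unfolding bilinear_def by (auto intro!: linearI simp: blinfun.bilinear_simps algebra_simps)
  then obtain T where T: "linear T" "\<And>x y. T (x \<otimes> y) = f x * g y"
    using tensor_universal[of "\<lambda>x y. f x * g y"] by blast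
  have T_le: "\<bar>T u\<bar> \<le> (norm f * norm g) * norm u" for u
  proof -
    have cost: "\<bar>T (tensor_sum xs)\<bar> \<le> (norm f * norm g) * cost xs" for xs
    proof (induction xs)
      case (Cons p xs)
      obtain x y where p: "p = (x, y)" by fastforce
      show ?case
        using Cons.IH bound[of x y] by (simp add: p linear_add[OF T(1)] T(2) distrib_left)
    qed (simp add: linear_0[OF T(1)])
    show ?thesis
    proof (cases "norm f * norm g = 0")
      case True
      then show ?thesis using tensor_sum_exists[of u] cost by fastforce
    next
      case False
      then have pos: "0 < norm f * norm g" by (simp add: less_le)
      have "\<bar>T u\<bar> / (norm f * norm g) \<le> norm u"
        unfolding norm_tensor_def
      proof (rule projective_norm_greatest)
        fix xs assume "u = tensor_sum xs"
        with cost[of xs] pos show "\<bar>T u\<bar> / (norm f * norm g) \<le> cost xs"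
          by (simp add: pos_divide_le_eq mult.commute)
      qed
      with pos show ?thesis by (simp add: pos_divide_le_eq mult.commute)
    qed
  qed
  have "bounded_linear T"
    by (rule bounded_linear_intro[of _ "norm f * norm g"])
       (use T_le in \<open>auto simp: linear_add[OF T(1)] linear_scale[OF T(1)] mult.commute\<close>)
  then obtain F :: "('a, 'b) projective_tensor \<Rightarrow>\<^sub>L real"
    where F: "\<And>x y. blinfun_apply F (x \<otimes>\<^sub>\<pi> y) = f x * g y"
    using completion_functional_extends[of "Blinfun T"] T(2)
    by (metis bounded_linear_Blinfun_apply elementary_def)
  have "norm F \<le> norm f * norm g"
    by (rule norm_projective_functional_le) (use F bound in auto)
  moreover have "norm f * norm g \<le> norm F"
  proof -
    have "\<bar>f x * g y\<bar> \<le> norm F * (norm x * norm y)" for x y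
    proof -
      have "\<bar>f x * g y\<bar> \<le> norm F * norm (x \<otimes>\<^sub>\<pi> y)"
        using norm_blinfun[of F "x \<otimes>\<^sub>\<pi> y"] by (simp add: F)
      also have "\<dots> \<le> norm F * (norm x * norm y)"
        by (intro mult_left_mono norm_elementary_le norm_ge_zero)
      finally show ?thesis .
    qed
    then have "norm (g y *\<^sub>R f) \<le> norm F * norm y" for y
      by (intro norm_blinfun_bound) (auto simp: blinfun.scaleR_left mult_ac)
    then have "norm (norm f *\<^sub>R g) \<le> norm F"
      by (intro norm_blinfun_bound) (auto simp: blinfun.scaleR_left abs_mult mult.commute)
    then show ?thesis by simp
  qed
  ultimately show ?thesis using F by (intro exI[of _ F]) auto
qed

lemma norm_elementary: "norm (x \<otimes>\<^sub>\<pi> y) = norm x * norm y"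
proof (rule antisym[OF norm_elementary_le])
  obtain f :: "'a \<Rightarrow>\<^sub>L real" where f: "norm f \<le> 1" "f x = norm x"
    using norming_functional by blast
  obtain g :: "'b \<Rightarrow>\<^sub>L real" where g: "norm g \<le> 1" "g y = norm y"
    using norming_functional by blast
  obtain F :: "('a, 'b) projective_tensor \<Rightarrow>\<^sub>L real"
    where F: "\<And>x y. blinfun_apply F (x \<otimes>\<^sub>\<pi> y) = f x * g y" "norm F = norm f * norm g"
    using functional_product by blast
  have "norm F \<le> 1" using f(1) g(1) by (simp add: F(2) mult_le_one)
  then have "norm F * norm (x \<otimes>\<^sub>\<pi> y) \<le> norm (x \<otimes>\<^sub>\<pi> y)" by (simp add: mult_left_le_one_le)
  with norm_blinfun[of F "x \<otimes>\<^sub>\<pi> y"] show "norm x * norm y \<le> norm (x \<otimes>\<^sub>\<pi> y)"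
    by (simp add: F(1) f(2) g(2))
qed

section \<open>Slices\<close>

lemma bounded_slice: "bounded (slice f \<alpha>)"
  by (rule bounded_subset[OF bounded_cball[of 0 1]]) (auto simp: slice_def)

lemma slice_mono: "\<alpha> \<le> \<beta> \<Longrightarrow> slice f \<alpha> \<subseteq> slice f \<beta>"
  by (auto simp: slice_def)

lemma slice_nonempty:
  fixes f :: "'a::real_normed_vector \<Rightarrow>\<^sub>L real"
  assumes "norm f = 1" "0 < \<alpha>" "\<alpha> < 1"
  shows "slice f \<alpha> \<noteq> {}"
proof
  assume "slice f \<alpha> = {}"
  then have le: "f x \<le> 1 - \<alpha>" if "norm x \<le> 1" for x
    using that by (force simp: slice_def)
  have "f x \<le> (1 - \<alpha>) * norm x" for x
  proof (cases "x = 0")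
    case False
    then show ?thesis
      using le[of "inverse (norm x) *\<^sub>R x"] by (simp add: blinfun.scaleR_right field_simps)
  qed simp
  from this this[of "- x" for x] have "norm f \<le> 1 - \<alpha>"
    using \<open>\<alpha> < 1\<close> by (intro norm_blinfun_bound) (auto simp: blinfun.minus_right abs_le_iff)
  with assms show False by simp
qed

text \<open>
  The restriction of \<open>F\<close> to an isometric copy of a space may have norm below 1, so it has to be
  renormalised; the threshold \<open>1 - \<alpha>\<close> is rescaled by the same factor and stays below 1 because
  the copy meets the slice.
\<close>

lemma slice_pullback:
  fixes J :: "'a::real_normed_vector \<Rightarrow> 'z::real_normed_vector" and F :: "'z \<Rightarrow>\<^sub>L real"
  assumes J: "linear J" and iso: "\<And>x. norm (J x) = norm x"
    and \<alpha>: "\<alpha> < 1" and x0: "J x0 \<in> slice F \<alpha>"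
  shows "\<exists>(f :: 'a \<Rightarrow>\<^sub>L real) \<beta>. norm f = 1 \<and> 0 < \<beta> \<and> \<beta> < 1 \<and>
           diameter (slice f \<beta>) \<le> diameter (slice F \<alpha>)"
proof -
  interpret J: linear J by fact
  have "bounded_linear J"
    by (rule bounded_linear_intro[of _ 1]) (simp_all add: J.add J.scale iso)
  define h where "h = F o\<^sub>L Blinfun J"
  have h: "h x = F (J x)" for x
    by (simp add: h_def bounded_linear_Blinfun_apply[OF \<open>bounded_linear J\<close>])
  have "norm x0 \<le> 1" "1 - \<alpha> < h x0"
    using x0 by (auto simp: slice_def h iso)
  moreover have "h x0 \<le> norm h * norm x0" using norm_blinfun[of h x0] by simp
  moreover have "norm h * norm x0 \<le> norm h" using \<open>norm x0 \<le> 1\<close> by (simp add: mult_left_le)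
  ultimately have nh: "1 - \<alpha> < norm h" by linarith
  with \<alpha> have pos: "0 < norm h" by linarith
  define f where "f = inverse (norm h) *\<^sub>R h"
  define \<beta> where "\<beta> = 1 - (1 - \<alpha>) / norm h"
  have "norm f = 1" using pos by (simp add: f_def)
  moreover have "0 < \<beta>" "\<beta> < 1" using nh \<alpha> pos by (simp_all add: \<beta>_def field_simps)
  moreover have sub: "J x \<in> slice F \<alpha>" if "x \<in> slice f \<beta>" for x
    using that pos
    by (simp add: slice_def f_def \<beta>_def blinfun.scaleR_left iso h divide_inverse[symmetric]
        mult.commute[of "inverse (norm h)"] divide_less_cancel)
  have "diameter (slice f \<beta>) \<le> diameter (slice F \<alpha>)"
  proof (rule diameter_le)
    show "slice f \<beta> \<noteq> {} \<or> 0 \<le> diameter (slice F \<alpha>)"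
      by (simp add: diameter_ge_0 bounded_slice)
    show "norm (x - y) \<le> diameter (slice F \<alpha>)" if "x \<in> slice f \<beta>" "y \<in> slice f \<beta>" for x y
      using diameter_bounded_bound[OF bounded_slice sub[OF that(1)] sub[OF that(2)]]
      by (simp add: dist_norm flip: iso J.diff)
  qed
  ultimately show ?thesis by blast
qed

section \<open>Dentability passes to the factors\<close>

text \<open>
  If \<open>F \<le> 1 - \<alpha>\<close> on all elementary tensors of unit vectors, then, these being symmetric about 0,
  the norm of \<open>F\<close> is at most \<open>1 - \<alpha>\<close>.
\<close>

lemma slice_contains_elementary:
  fixes F :: "('a::real_normed_vector, 'b::real_normed_vector) projective_tensor \<Rightarrow>\<^sub>L real"
  assumes F: "norm F = 1" and \<alpha>: "0 < \<alpha>" "\<alpha> < 1"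
  obtains x y where "norm x = 1" "norm y = 1" "x \<otimes>\<^sub>\<pi> y \<in> slice F \<alpha>"
proof (rule ccontr)
  assume "\<not> thesis"
  with that have le: "F (x \<otimes>\<^sub>\<pi> y) \<le> 1 - \<alpha>" if "norm x = 1" "norm y = 1" for x y
    using that by (force simp: slice_def norm_elementary)
  have pos: "F (x \<otimes>\<^sub>\<pi> y) \<le> (1 - \<alpha>) * (norm x * norm y)" for x y
  proof (cases "x = 0 \<or> y = 0")
    case True
    then show ?thesis
      by (auto simp: bilinear_lzero[OF bilinear_elementary] bilinear_rzero[OF bilinear_elementary])
  next
    case False
    then have "F ((inverse (norm x) *\<^sub>R x) \<otimes>\<^sub>\<pi> (inverse (norm y) *\<^sub>R y)) \<le> 1 - \<alpha>"
      by (intro le) auto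
    with False show ?thesis
      by (simp add: bilinear_lmul[OF bilinear_elementary] bilinear_rmul[OF bilinear_elementary]
          blinfun.scaleR_right field_simps)
  qed
  have "\<bar>F (x \<otimes>\<^sub>\<pi> y)\<bar> \<le> (1 - \<alpha>) * (norm x * norm y)" for x y
    using pos[of x y] pos[of "- x" y]
    by (simp add: bilinear_lneg[OF bilinear_elementary] blinfun.minus_right abs_le_iff)
  then have "norm F \<le> 1 - \<alpha>"
    using \<alpha> by (intro norm_projective_functional_le) auto
  with F \<alpha> show False by simp
qed

lemma BDP_factors:
  assumes "BDP TYPE(('a::real_normed_vector, 'b::real_normed_vector) projective_tensor)"
  shows "BDP TYPE('a) \<and> BDP TYPE('b)"
proof -
  have "(\<exists>(f :: 'a \<Rightarrow>\<^sub>L real) \<beta>. norm f = 1 \<and> 0 < \<beta> \<and> \<beta> < 1 \<and> diameter (slice f \<beta>) < \<epsilon>) \<and>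
        (\<exists>(g :: 'b \<Rightarrow>\<^sub>L real) \<beta>. norm g = 1 \<and> 0 < \<beta> \<and> \<beta> < 1 \<and> diameter (slice g \<beta>) < \<epsilon>)"
    if \<epsilon>: "0 < \<epsilon>" for \<epsilon>
  proof -
    obtain F :: "('a, 'b) projective_tensor \<Rightarrow>\<^sub>L real" and \<alpha>
      where F: "norm F = 1" "0 < \<alpha>" "\<alpha> < 1" "diameter (slice F \<alpha>) < \<epsilon>"
      using assms \<epsilon> unfolding BDP_def by blast
    obtain x y where xy: "norm x = 1" "norm y = 1" "x \<otimes>\<^sub>\<pi> y \<in> slice F \<alpha>"
      using slice_contains_elementary[OF F(1-3)] by blast
    have "linear (\<lambda>x. x \<otimes>\<^sub>\<pi> y)" "linear (\<lambda>y. x \<otimes>\<^sub>\<pi> y)"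
      using bilinear_elementary unfolding bilinear_def by blast+
    from slice_pullback[OF this(1) _ F(3) xy(3)] slice_pullback[OF this(2) _ F(3) xy(3)]
    show ?thesis
      using F(4) xy(1,2) by (auto simp: norm_elementary intro: le_less_trans)
  qed
  then show ?thesis unfolding BDP_def by blast
qed

section \<open>Dentability passes to the projective tensor product\<close>

text \<open>
  The last summand pays for everything that happens outside the slices: where
  \<open>f x * g y \<le> 1 - \<alpha>\<close> it is at least 2, the most that two points of the ball can differ by.
  Elsewhere \<open>(x, y)\<close> or \<open>(- x, - y)\<close> lies in the product of the slices, and replacing one factor
  at a time costs \<open>\<delta>\<close> each.
\<close>

lemma unit_elementary_near:
  fixes f :: "'a::real_normed_vector \<Rightarrow>\<^sub>L real" and g :: "'b::real_normed_vector \<Rightarrow>\<^sub>L real"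
  assumes f: "norm f \<le> 1" and g: "norm g \<le> 1" and \<alpha>: "0 < \<alpha>" "\<alpha> < 1"
    and x0: "x0 \<in> slice f \<alpha>" and y0: "y0 \<in> slice g \<alpha>"
    and df: "\<And>x. x \<in> slice f \<alpha> \<Longrightarrow> norm (x - x0) \<le> \<delta>"
    and dg: "\<And>y. y \<in> slice g \<alpha> \<Longrightarrow> norm (y - y0) \<le> \<delta>"
    and x: "norm x = 1" and y: "norm y = 1"
  shows "norm (x \<otimes>\<^sub>\<pi> y - (f x * g y) *\<^sub>R (x0 \<otimes>\<^sub>\<pi> y0)) \<le> 2 * \<delta> + 2 / \<alpha> * (1 - f x * g y)"
proof -
  let ?e = "x0 \<otimes>\<^sub>\<pi> y0" and ?s = "f x * g y"
  have n0: "norm x0 \<le> 1" "norm y0 \<le> 1" using x0 y0 by (auto simp: slice_def)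
  then have e: "norm ?e \<le> 1" by (simp add: norm_elementary mult_le_one)
  have \<delta>: "0 \<le> \<delta>" using df[OF x0] by simp
  have fx: "\<bar>f x\<bar> \<le> 1" using norm_blinfun[of f x] f x by simp
  have gy: "\<bar>g y\<bar> \<le> 1" using norm_blinfun[of g y] g y by simp
  have s: "\<bar>?s\<bar> \<le> 1" unfolding abs_mult using fx gy by (simp add: mult_le_one)
  show ?thesis
  proof (cases "1 - \<alpha> < ?s")
    case False
    \<comment> \<open>Far from norming: both terms have norm at most 1.\<close>
    have "norm (?s *\<^sub>R ?e) \<le> 1"
      unfolding norm_scaleR using s e by (intro mult_le_one) auto
    then have "norm (x \<otimes>\<^sub>\<pi> y - ?s *\<^sub>R ?e) \<le> 2"
      using norm_triangle_ineq4[of "x \<otimes>\<^sub>\<pi> y" "?s *\<^sub>R ?e"] by (simp add: norm_elementary x y)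
    also have "2 \<le> 2 / \<alpha> * (1 - ?s)" using False \<alpha> by (simp add: field_simps)
    finally show ?thesis using \<delta> by simp
  next
    case True
    have near: "norm (x' \<otimes>\<^sub>\<pi> y' - ?e) \<le> 2 * \<delta>"
      if x': "norm x' = 1" "1 - \<alpha> < f x'" and y': "norm y' = 1" "1 - \<alpha> < g y'" for x' y'
    proof -
      have "x' \<otimes>\<^sub>\<pi> y' - ?e = (x' - x0) \<otimes>\<^sub>\<pi> y' + x0 \<otimes>\<^sub>\<pi> (y' - y0)"
        by (simp add: bilinear_lsub[OF bilinear_elementary] bilinear_rsub[OF bilinear_elementary])
      then have "norm (x' \<otimes>\<^sub>\<pi> y' - ?e) \<le> norm (x' - x0) * norm y' + norm x0 * norm (y' - y0)"
        using norm_triangle_ineq[of "(x' - x0) \<otimes>\<^sub>\<pi> y'" "x0 \<otimes>\<^sub>\<pi> (y' - y0)"]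
        by (simp add: norm_elementary)
      also have "\<dots> \<le> \<delta> * 1 + 1 * \<delta>"
        using df[of x'] dg[of y'] x' y' n0 \<delta> by (intro add_mono mult_mono) (auto simp: slice_def)
      finally show ?thesis by simp
    qed
    \<comment> \<open>A product above \<open>1 - \<alpha>\<close> of factors in \<open>[-1, 1]\<close> has both factors above \<open>1 - \<alpha>\<close> in
      absolute value, with equal signs.\<close>
    have pos: "0 < ?s" using True \<alpha> by linarith
    have "\<bar>?s\<bar> \<le> \<bar>f x\<bar>" "\<bar>?s\<bar> \<le> \<bar>g y\<bar>"
      unfolding abs_mult using fx gy by (simp_all add: mult_left_le mult_left_le_one_le)
    with True pos have abs: "1 - \<alpha> < \<bar>f x\<bar>" "1 - \<alpha> < \<bar>g y\<bar>" by auto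
    have "norm (x \<otimes>\<^sub>\<pi> y - ?e) \<le> 2 * \<delta>"
    proof (cases "0 < f x")
      case True
      with pos have "0 < g y" by (simp add: zero_less_mult_iff)
      with True show ?thesis using near[of x y] abs x y by simp
    next
      case False
      with pos have "f x < 0" "g y < 0" by (auto simp: zero_less_mult_iff)
      then have "norm ((- x) \<otimes>\<^sub>\<pi> (- y) - ?e) \<le> 2 * \<delta>"
        using abs x y by (intro near) (auto simp: blinfun.minus_right)
      then show ?thesis
        by (simp add: bilinear_lneg[OF bilinear_elementary] bilinear_rneg[OF bilinear_elementary])
    qed
    moreover have "norm ((1 - ?s) *\<^sub>R ?e) \<le> 2 / \<alpha> * (1 - ?s)"
    proof -
      have "norm ((1 - ?s) *\<^sub>R ?e) \<le> (1 - ?s) * 1"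
        unfolding norm_scaleR using s e by (intro mult_mono) auto
      also have "\<dots> \<le> (1 - ?s) * (2 / \<alpha>)"
        using s \<alpha> by (intro mult_left_mono) (auto simp: field_simps)
      finally show ?thesis by (simp add: mult.commute)
    qed
    moreover have "x \<otimes>\<^sub>\<pi> y - ?s *\<^sub>R ?e = (x \<otimes>\<^sub>\<pi> y - ?e) + (1 - ?s) *\<^sub>R ?e"
      by (simp add: algebra_simps)
    then have "norm (x \<otimes>\<^sub>\<pi> y - ?s *\<^sub>R ?e) \<le> norm (x \<otimes>\<^sub>\<pi> y - ?e) + norm ((1 - ?s) *\<^sub>R ?e)"
      by (simp only: norm_triangle_ineq)
    ultimately show ?thesis by linarith
  qed
qed

text \<open>
  Once \<open>F z\<close> is moved to the left, homogeneity and subadditivity carry the estimate from unit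
  vectors to the whole space, with no need to write \<open>z\<close> as a convex combination.
\<close>

lemma projective_tensor_near:
  fixes f :: "'a::real_normed_vector \<Rightarrow>\<^sub>L real" and g :: "'b::real_normed_vector \<Rightarrow>\<^sub>L real"
  assumes f: "norm f \<le> 1" and g: "norm g \<le> 1" and \<alpha>: "0 < \<alpha>" "\<alpha> < 1"
    and x0: "x0 \<in> slice f \<alpha>" and y0: "y0 \<in> slice g \<alpha>"
    and df: "\<And>x. x \<in> slice f \<alpha> \<Longrightarrow> norm (x - x0) \<le> \<delta>"
    and dg: "\<And>y. y \<in> slice g \<alpha> \<Longrightarrow> norm (y - y0) \<le> \<delta>"
    and F: "\<And>x y. blinfun_apply F (x \<otimes>\<^sub>\<pi> y) = f x * g y"
  shows "norm (z - F z *\<^sub>R (x0 \<otimes>\<^sub>\<pi> y0)) \<le> 2 * \<delta> * norm z + 2 / \<alpha> * (norm z - F z)"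
proof -
  let ?e = "x0 \<otimes>\<^sub>\<pi> y0"
  define \<phi> where "\<phi> z = norm (z - F z *\<^sub>R ?e) + 2 / \<alpha> * F z" for z
  have \<delta>: "0 \<le> \<delta>" using df[OF x0] by simp
  have "\<phi> z \<le> (2 * \<delta> + 2 / \<alpha>) * norm z"
  proof (rule subadditive_le_projective_norm)
    show "continuous_on UNIV \<phi>" unfolding \<phi>_def by (intro continuous_intros)
    show "\<phi> 0 = 0" by (simp add: \<phi>_def)
    show "\<phi> (z + w) \<le> \<phi> z + \<phi> w" for z w
      using norm_triangle_ineq[of "z - F z *\<^sub>R ?e" "w - F w *\<^sub>R ?e"]
      by (simp add: \<phi>_def blinfun.add_right algebra_simps add_divide_distrib)
    show "0 \<le> 2 * \<delta> + 2 / \<alpha>" using \<delta> \<alpha> by simp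
    show "\<phi> (x \<otimes>\<^sub>\<pi> y) \<le> (2 * \<delta> + 2 / \<alpha>) * (norm x * norm y)" for x y
    proof (cases "x = 0 \<or> y = 0")
      case True
      then show ?thesis
        by (auto simp: \<phi>_def bilinear_lzero[OF bilinear_elementary]
            bilinear_rzero[OF bilinear_elementary])
    next
      case False
      define c u v where "c = norm x * norm y" and "u = inverse (norm x) *\<^sub>R x"
        and "v = inverse (norm y) *\<^sub>R y"
      have c: "0 \<le> c" by (simp add: c_def)
      have "norm u = 1" "norm v = 1" using False by (simp_all add: u_def v_def)
      from unit_elementary_near[OF f g \<alpha> x0 y0 df dg this]
      have unit: "\<phi> (u \<otimes>\<^sub>\<pi> v) \<le> 2 * \<delta> + 2 / \<alpha>" by (simp add: \<phi>_def F algebra_simps)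
      have xy: "x \<otimes>\<^sub>\<pi> y = c *\<^sub>R (u \<otimes>\<^sub>\<pi> v)"
        using False by (simp add: c_def u_def v_def bilinear_lmul[OF bilinear_elementary]
            bilinear_rmul[OF bilinear_elementary] field_simps)
      have "\<phi> (x \<otimes>\<^sub>\<pi> y) = norm (c *\<^sub>R (u \<otimes>\<^sub>\<pi> v - F (u \<otimes>\<^sub>\<pi> v) *\<^sub>R ?e)) + c * (2 / \<alpha> * F (u \<otimes>\<^sub>\<pi> v))"
        by (simp add: xy \<phi>_def blinfun.scaleR_right scaleR_diff_right)
      also have "\<dots> = c * \<phi> (u \<otimes>\<^sub>\<pi> v)"
        using c by (simp add: \<phi>_def distrib_left)
      also have "\<dots> \<le> c * (2 * \<delta> + 2 / \<alpha>)" by (rule mult_left_mono[OF unit c])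
      finally show ?thesis by (simp add: c_def mult.commute)
    qed
  qed
  then show ?thesis by (simp add: \<phi>_def algebra_simps)
qed

lemma BDP_projective_tensor:
  assumes X: "BDP TYPE('a::real_normed_vector)" and Y: "BDP TYPE('b::real_normed_vector)"
  shows "BDP TYPE(('a, 'b) projective_tensor)"
  unfolding BDP_def
proof (intro allI impI)
  fix \<epsilon> :: real assume \<epsilon>: "0 < \<epsilon>"
  \<comment> \<open>The slice found below lies within \<open>2 * \<delta> + 3 * \<beta> / \<alpha>\<close> of one point; \<open>\<beta>\<close> is chosen to make
    this at most \<open>3 * \<delta>\<close>, so the diameter is at most \<open>6 * \<delta>\<close>, which is half of \<open>\<epsilon>\<close>.\<close>
  define \<delta> where "\<delta> = \<epsilon> / 12"
  have \<delta>: "0 < \<delta>" using \<epsilon> by (simp add: \<delta>_def)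
  obtain f :: "'a \<Rightarrow>\<^sub>L real" and \<alpha>1
    where f: "norm f = 1" "0 < \<alpha>1" "\<alpha>1 < 1" "diameter (slice f \<alpha>1) < \<delta>"
    using X \<delta> unfolding BDP_def by blast
  obtain g :: "'b \<Rightarrow>\<^sub>L real" and \<alpha>2
    where g: "norm g = 1" "0 < \<alpha>2" "\<alpha>2 < 1" "diameter (slice g \<alpha>2) < \<delta>"
    using Y \<delta> unfolding BDP_def by blast
  define \<alpha> where "\<alpha> = min \<alpha>1 \<alpha>2"
  have \<alpha>: "0 < \<alpha>" "\<alpha> < 1" using f g by (auto simp: \<alpha>_def)
  obtain x0 y0 where x0: "x0 \<in> slice f \<alpha>" and y0: "y0 \<in> slice g \<alpha>"
    using slice_nonempty[OF f(1) \<alpha>] slice_nonempty[OF g(1) \<alpha>] by blast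
  have sub: "slice f \<alpha> \<subseteq> slice f \<alpha>1" "slice g \<alpha> \<subseteq> slice g \<alpha>2"
    by (simp_all add: \<alpha>_def slice_mono)
  have df: "norm (x - x0) \<le> \<delta>" if "x \<in> slice f \<alpha>" for x
    using diameter_bounded_bound[OF bounded_slice, of x f \<alpha>1 x0] that x0 sub f(4)
    by (fastforce simp: dist_norm)
  have dg: "norm (y - y0) \<le> \<delta>" if "y \<in> slice g \<alpha>" for y
    using diameter_bounded_bound[OF bounded_slice, of y g \<alpha>2 y0] that y0 sub g(4)
    by (fastforce simp: dist_norm)
  obtain F :: "('a, 'b) projective_tensor \<Rightarrow>\<^sub>L real"
    where F: "\<And>x y. blinfun_apply F (x \<otimes>\<^sub>\<pi> y) = f x * g y" and nF: "norm F = 1"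
    using functional_product[of f g] f(1) g(1) by auto
  define \<beta> where "\<beta> = min (1 / 2) (\<alpha> * \<delta> / 3)"
  have \<beta>: "0 < \<beta>" "\<beta> < 1" "3 * \<beta> \<le> \<alpha> * \<delta>" using \<alpha> \<delta> by (auto simp: \<beta>_def min_def)
  let ?e = "x0 \<otimes>\<^sub>\<pi> y0"
  have near: "norm (z - ?e) \<le> 3 * \<delta>" if z: "z \<in> slice F \<beta>" for z
  proof -
    have nz: "norm z \<le> 1" and Fz: "1 - \<beta> < F z" using z by (auto simp: slice_def)
    have F1: "F z \<le> 1" using norm_blinfun[of F z] nF nz by simp
    have e: "norm ?e \<le> 1"
      using x0 y0 by (simp add: norm_elementary slice_def mult_le_one)
    have "norm (z - F z *\<^sub>R ?e) \<le> 2 * \<delta> * norm z + 2 / \<alpha> * (norm z - F z)"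
      by (rule projective_tensor_near[OF _ _ \<alpha> x0 y0 df dg F]) (simp_all add: f(1) g(1))
    also have "\<dots> \<le> 2 * \<delta> * 1 + 2 / \<alpha> * \<beta>"
      using nz Fz \<delta> \<alpha> by (intro add_mono mult_left_mono) auto
    finally have 1: "norm (z - F z *\<^sub>R ?e) \<le> 2 * \<delta> + 2 * \<beta> / \<alpha>" by simp
    have "norm ((1 - F z) *\<^sub>R ?e) \<le> \<beta> * 1"
      unfolding norm_scaleR using F1 Fz e \<beta> by (intro mult_mono) auto
    also have "\<dots> \<le> \<beta> / \<alpha>" using \<alpha> \<beta> by (simp add: field_simps)
    finally have 2: "norm ((1 - F z) *\<^sub>R ?e) \<le> \<beta> / \<alpha>" .
    have "2 * \<beta> / \<alpha> + \<beta> / \<alpha> \<le> \<delta>" using \<beta>(3) \<alpha> by (simp add: field_simps)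
    moreover have "z - ?e = (z - F z *\<^sub>R ?e) - (1 - F z) *\<^sub>R ?e" by (simp add: algebra_simps)
    then have "norm (z - ?e) \<le> norm (z - F z *\<^sub>R ?e) + norm ((1 - F z) *\<^sub>R ?e)"
      by (simp only: norm_triangle_ineq4)
    ultimately show ?thesis using 1 2 by linarith
  qed
  have "diameter (slice F \<beta>) \<le> 6 * \<delta>"
  proof (rule diameter_le)
    show "norm (z - w) \<le> 6 * \<delta>" if "z \<in> slice F \<beta>" "w \<in> slice F \<beta>" for z w
      using near[OF that(1)] near[OF that(2)] norm_triangle_ineq4[of "z - ?e" "w - ?e"] by simp
  qed (use \<delta> in simp)
  also have "\<dots> < \<epsilon>" using \<epsilon> by (simp add: \<delta>_def)
  finally show "\<exists>(F :: ('a, 'b) projective_tensor \<Rightarrow>\<^sub>L real) \<beta>.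
      norm F = 1 \<and> 0 < \<beta> \<and> \<beta> < 1 \<and> diameter (slice F \<beta>) < \<epsilon>"
    using nF \<beta> by blast
qed

theorem corollary2p8:
  shows "BDP TYPE(('a::banach, 'b::banach) projective_tensor) \<longleftrightarrow> BDP TYPE('a) \<and> BDP TYPE('b)"
  using BDP_factors BDP_projective_tensor by blast

end
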